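(* Let $\psi$ be a zero-symmetric concave function on $\mathbb R$ such that $\psi(x)=-\infty$ if and only if $x\notin[-Z_{(2n)},Z_{(2n)}]$, where $Z_{(2n)}=\max_{1\le i\le n}\max(|X_i-\check u_{1,n}|,|X_i-\check u_{2,n}|)$, and $\psi'(0)=0$. If $\exp(\psi)=\widehat f_n$ is the MLE (defined in the context), then for any real zero-symmetric function $\Delta$ such that $\psi+\epsilon\Delta\in\mathcal{SC}$ for some $\epsilon>0$ we have $$\frac1n\sum_{i=1}^n\Big\{\widehat p_n(X_i)\,\Delta(X_i-\check u_{1,n})+(1-\widehat p_n(X_i))\,\Delta(X_i-\check u_{2,n})\Big\}\le\int_{\mathbb R}\widehat f_n(x)\Delta(x)\,dx,$$ where, for $i=1,\dots,n$, $$\widehat p_n(X_i)=\frac{\check\pi_n\widehat f_n(X_i-\check u_{1,n})}{\check\pi_n\widehat f_n(X_i-\check u_{1,n})+(1-\check\pi_n)\widehat f_n(X_i-\check u_{2,n})}.$$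
   Context: "Zero-symmetric" means $h(x)=h(-x)$ for all $x$. $\mathcal{SC}$ is the class of concave functions $\psi:\mathbb R\to[-\infty,\infty)$ that are upper semicontinuous, proper (not identically $-\infty$), and zero-symmetric; $\mathcal{SLC}=\{e^\psi:\psi\in\mathcal{SC}\}$; $\mathcal{SLC}_1=\{f\in\mathcal{SLC}:\int_{\mathbb R}f=1\}$. $X_1,\dots,X_n$ are i.i.d. with density $g^0(x)=\pi^0 f^0(x-u^0_1)+(1-\pi^0)f^0(x-u^0_2)$, where $f^0\in\mathcal{SLC}_1$, $\pi^0\in(0,1)\setminus\{1/2\}$, $u^0_1\neq u^0_2$ real. $\check\pi_n,\check u_{1,n},\check u_{2,n}$ are estimators (functions of $X_1,\dots,X_n$) with $\check\pi_n\in(0,1)\setminus\{1/2\}$ and $\check u_{1,n}<\check u_{2,n}$. The MLE is $\widehat f_n=e^{\widehat\psi_n}$, where $\widehat\psi_n$ maximizes over $\mathcal{SC}$ the criterion $$\Phi_n(\psi)=\frac1n\sum_{i=1}^n\log\big[\check\pi_n e^{\psi(X_i-\check u_{1,n})}+(1-\check\pi_n)e^{\psi(X_i-\check u_{2,n})}\big]-\int_{\mathbb R}e^{\psi(x)}dx.$$ *)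

theory Defs
  imports "HOL-Probability.Probability"
begin

definition zero_symmetric :: "(real \<Rightarrow> 'a) \<Rightarrow> bool" where
  "zero_symmetric h \<longleftrightarrow> (\<forall>x. h x = h (- x))"

(* Functions into [-oo, oo) are rendered as ereal-valued functions that avoid +oo. The clause
   below guarantees that the extended sum never has the form oo + (-oo). *)
definition concave_ext :: "(real \<Rightarrow> ereal) \<Rightarrow> bool" where
  "concave_ext \<psi> \<longleftrightarrow> (\<forall>x. \<psi> x < \<infinity>) \<and>
     (\<forall>x y. \<forall>t\<in>{0<..<1}.
        ereal (1 - t) * \<psi> x + ereal t * \<psi> y \<le> \<psi> ((1 - t) * x + t * y))"

definition upper_semicontinuous :: "(real \<Rightarrow> ereal) \<Rightarrow> bool" where
  "upper_semicontinuous \<psi> \<longleftrightarrow> (\<forall>x. Limsup (at x) \<psi> \<le> \<psi> x)"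

definition SC :: "(real \<Rightarrow> ereal) set" where
  "SC = {\<psi>. concave_ext \<psi> \<and> upper_semicontinuous \<psi> \<and> (\<exists>x. \<psi> x \<noteq> -\<infinity>) \<and> zero_symmetric \<psi>}"

(* e^a for a in [-oo, oo); the value at +oo is irrelevant. *)
definition exp_ext :: "ereal \<Rightarrow> real" where
  "exp_ext a = (if a = -\<infinity> then 0 else exp (real_of_ereal a))"

(* log y for y in [0, oo), with log 0 = -oo *)
definition log_ext :: "real \<Rightarrow> ereal" where
  "log_ext y = (if y = 0 then -\<infinity> else ereal (ln y))"

definition SLC :: "(real \<Rightarrow> real) set" where
  "SLC = {\<lambda>x. exp_ext (\<psi> x) | \<psi>. \<psi> \<in> SC}"

(* The Bochner integral of a non-integrable function is 0, so the value 1 forces integrability. *)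
definition SLC1 :: "(real \<Rightarrow> real) set" where
  "SLC1 = {f \<in> SLC. (\<integral>x. f x \<partial>lborel) = 1}"

definition mixture :: "real \<Rightarrow> real \<Rightarrow> real \<Rightarrow> (real \<Rightarrow> real) \<Rightarrow> real \<Rightarrow> real" where
  "mixture p u1 u2 f x = p * f (x - u1) + (1 - p) * f (x - u2)"

(* The integral may be infinite for psi in SC, e.g. for constant psi, and the logarithms may be -oo.
   Since neither term can be +oo, the criterion is well defined in [-oo, oo). *)
definition Phi :: "nat \<Rightarrow> (nat \<Rightarrow> real) \<Rightarrow> real \<Rightarrow> real \<Rightarrow> real \<Rightarrow> (real \<Rightarrow> ereal) \<Rightarrow> ereal" where
  "Phi n x p u1 u2 \<psi> =
     ereal (1 / real n) * (\<Sum>i=1..n. log_ext (mixture p u1 u2 (\<lambda>y. exp_ext (\<psi> y)) (x i)))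
     - enn2ereal (\<integral>\<^sup>+y. ennreal (exp_ext (\<psi> y)) \<partial>lborel)"

definition is_MLE ::
  "nat \<Rightarrow> (nat \<Rightarrow> real) \<Rightarrow> real \<Rightarrow> real \<Rightarrow> real \<Rightarrow> (real \<Rightarrow> real) \<Rightarrow> bool" where
  "is_MLE n x p u1 u2 f \<longleftrightarrow>
     (\<exists>\<psi>. is_arg_max (Phi n x p u1 u2) (\<lambda>\<phi>. \<phi> \<in> SC) \<psi> \<and> f = (\<lambda>y. exp_ext (\<psi> y)))"

definition Z_max :: "nat \<Rightarrow> (nat \<Rightarrow> real) \<Rightarrow> real \<Rightarrow> real \<Rightarrow> real" where
  "Z_max n x u1 u2 = (MAX i\<in>{1..n}. max \<bar>x i - u1\<bar> \<bar>x i - u2\<bar>)"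

definition p_hat :: "real \<Rightarrow> real \<Rightarrow> real \<Rightarrow> (real \<Rightarrow> real) \<Rightarrow> real \<Rightarrow> real" where
  "p_hat p u1 u2 f x = p * f (x - u1) / (p * f (x - u1) + (1 - p) * f (x - u2))"

(* The observed sample, as the argument of the estimators: it is restricted to the indices 1..n,
   so that a function of it depends on the first n observations only. *)
definition obs :: "nat \<Rightarrow> (nat \<Rightarrow> 'a \<Rightarrow> real) \<Rightarrow> 'a \<Rightarrow> nat \<Rightarrow> real" where
  "obs n X \<omega> = (\<lambda>i\<in>{1..n}. X i \<omega>)"

end

theory Submission
  imports Defs
begin

text \<open>
  The idea is to move from the maximizer \<open>\<psi>\<close> a short way in the direction \<open>\<Delta>\<close>. Since \<open>SC\<close> is stable
  under convex combinations, the whole segment \<open>\<psi> + t \<Delta>\<close> with \<open>0 < t < \<epsilon>\<close> stays in \<open>SC\<close>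
  (\<open>SC_perturbation_segment\<close>), and maximality says that the gain in mean log-likelihood along this
  segment is at most the gain in total mass of \<open>exp (\<psi> + t \<Delta>)\<close>. Dividing by \<open>t\<close> and letting
  \<open>t\<close> tend to \<open>0\<close> turns this into the claimed inequality between the two derivatives.

  The two sides are treated differently. The log-likelihood of a two-component mixture is a
  log-sum-exp, hence convex in \<open>t\<close>, so it lies above its tangent at \<open>0\<close>; the slope there is exactly
  the mean of \<open>\<Delta>\<close> weighted by the posterior probabilities \<open>p_hat\<close> (\<open>weighted_mean_le_ln_tilt\<close>).
  Thus the likelihood side is bounded below by a linear function of \<open>t\<close>, and only the mass needs a
  limit. For it, \<open>exp z \<le> 1 + z + z\<^sup>2\<close> gives an error of order \<open>t\<^sup>2\<close>, provided that \<open>\<Delta>\<close> is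
  bounded on the support (\<open>integral_exponential_tilt_first_order\<close>).

  Boundedness and measurability of \<open>\<Delta>\<close> come from concavity and symmetry: both \<open>\<psi>\<close> and
  \<open>\<psi> + \<epsilon> \<Delta>\<close> are nonincreasing in the distance to the origin
  (\<open>zero_symmetric_concave_mono_abs\<close>) and are finite on the compact support \<open>[-Z, Z]\<close>. They are
  therefore bounded there by their values at \<open>0\<close> and \<open>Z\<close>, and \<open>\<Delta>\<close> is a multiple of their
  difference. All data points shifted by either location lie in the support, so every logarithm in
  the criterion is finite.
\<close>

section \<open>Exponentials of extended reals\<close>

lemma exp_ext_pos: "a < \<infinity> \<Longrightarrow> 0 < exp_ext a \<longleftrightarrow> a \<noteq> -\<infinity>"
  by (simp add: exp_ext_def)

lemma exp_ext_inject: "a < \<infinity> \<Longrightarrow> b < \<infinity> \<Longrightarrow> exp_ext a = exp_ext b \<Longrightarrow> a = b"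
  by (cases a; cases b) (auto simp: exp_ext_def)

lemma exp_ext_add: "a < \<infinity> \<Longrightarrow> exp_ext (a + ereal r) = exp_ext a * exp r"
  by (cases a) (auto simp: exp_ext_def exp_add)

lemma exp_ext_mono: "a \<le> b \<Longrightarrow> b < \<infinity> \<Longrightarrow> exp_ext a \<le> exp_ext b"
  by (cases a; cases b) (auto simp: exp_ext_def)

section \<open>Symmetric concave functions\<close>

text \<open>
  A point closer to the origin than \<open>y\<close> is a convex combination of \<open>y\<close> and \<open>- y\<close>, where \<open>\<phi>\<close> takes
  the same value.
\<close>

lemma zero_symmetric_concave_mono_abs:
  assumes "zero_symmetric \<phi>" "concave_ext \<phi>" "\<bar>x\<bar> \<le> \<bar>y\<bar>"
  shows "\<phi> y \<le> \<phi> x"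
proof (cases "\<bar>x\<bar> = \<bar>y\<bar>")
  case True
  then show ?thesis using assms(1) by (auto simp: zero_symmetric_def abs_eq_iff)
next
  case False
  hence lt: "\<bar>x\<bar> < \<bar>y\<bar>" using assms(3) by simp
  define t where "t = (1 - x / y) / 2"
  have ny: "y \<noteq> 0" using lt by auto
  have "\<bar>x / y\<bar> < 1" using lt ny by (simp add: field_simps)
  hence "- 1 < x / y" "x / y < 1" unfolding abs_less_iff by linarith+
  hence t: "t \<in> {0<..<1}" by (auto simp: t_def)
  have "(1 - t) * y + t * (- y) = x" using ny by (simp add: t_def field_simps)
  hence "ereal (1 - t) * \<phi> y + ereal t * \<phi> (- y) \<le> \<phi> x"
    using assms(2) t unfolding concave_ext_def by metis
  moreover have "\<phi> (- y) = \<phi> y" using assms(1) by (simp add: zero_symmetric_def)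
  moreover have "ereal (1 - t) * \<phi> y + ereal t * \<phi> y = \<phi> y"
    using t by (cases "\<phi> y") (auto simp: algebra_simps)
  ultimately show ?thesis by simp
qed

text \<open>
  By symmetry the function factors through the absolute value, and the factor is monotone.
\<close>

lemma exp_ext_measurable:
  assumes "zero_symmetric \<phi>" "concave_ext \<phi>"
  shows "(\<lambda>y. exp_ext (\<phi> y)) \<in> borel_measurable borel"
proof -
  have fin: "\<phi> y < \<infinity>" for y using assms(2) by (simp add: concave_ext_def)
  \<comment> \<open>Truncation at \<open>0\<close> makes the monotone half of the function monotone on the whole line.\<close>
  have "mono (\<lambda>r. - exp_ext (\<phi> (max r 0)))"
    by (intro monoI) (auto intro!: exp_ext_mono fin zero_symmetric_concave_mono_abs[OF assms])
  hence "(\<lambda>r. - exp_ext (\<phi> (max r 0))) \<in> borel_measurable borel"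
    by (rule borel_measurable_mono)
  hence "(\<lambda>r. - (- exp_ext (\<phi> (max \<bar>r\<bar> 0)))) \<in> borel_measurable borel"
    by measurable
  moreover have "\<phi> (max \<bar>r\<bar> 0) = \<phi> r" for r
    using assms(1) by (auto simp: zero_symmetric_def abs_if)
  ultimately show ?thesis by simp
qed

lemma concave_ext_convex_combination:
  assumes "concave_ext \<phi>" "concave_ext \<psi>" "0 < s" "s < 1"
  shows "concave_ext (\<lambda>y. ereal (1 - s) * \<phi> y + ereal s * \<psi> y)"
proof -
  have fin: "\<phi> y < \<infinity>" "\<psi> y < \<infinity>" for y using assms(1,2) by (simp_all add: concave_ext_def)
  have "ereal (1 - s) * \<phi> y + ereal s * \<psi> y < \<infinity>" for y
    using fin[of y] assms(3,4) by (cases "\<phi> y"; cases "\<psi> y") auto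
  moreover have "ereal (1 - t) * (ereal (1 - s) * \<phi> x + ereal s * \<psi> x)
        + ereal t * (ereal (1 - s) * \<phi> y + ereal s * \<psi> y)
      \<le> ereal (1 - s) * \<phi> ((1 - t) * x + t * y) + ereal s * \<psi> ((1 - t) * x + t * y)"
    if t: "t \<in> {0<..<1}" for x y t
  proof -
    have "ereal (1 - t) * (ereal (1 - s) * \<phi> x + ereal s * \<psi> x)
        + ereal t * (ereal (1 - s) * \<phi> y + ereal s * \<psi> y)
      = ereal (1 - s) * (ereal (1 - t) * \<phi> x + ereal t * \<phi> y)
        + ereal s * (ereal (1 - t) * \<psi> x + ereal t * \<psi> y)"
      using fin[of x] fin[of y] t assms(3,4)
      by (cases "\<phi> x"; cases "\<psi> x"; cases "\<phi> y"; cases "\<psi> y") (auto simp: algebra_simps)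
    also have "\<dots> \<le> ereal (1 - s) * \<phi> ((1 - t) * x + t * y) + ereal s * \<psi> ((1 - t) * x + t * y)"
      using assms t by (intro add_mono ereal_mult_left_mono) (auto simp: concave_ext_def)
    finally show ?thesis .
  qed
  ultimately show ?thesis by (simp add: concave_ext_def)
qed


text \<open>
  Any real \<open>d\<close> above the combination at \<open>x\<close> splits as the same combination of reals \<open>a\<close> and \<open>b\<close>
  above the two values, and each function stays below its own bound near \<open>x\<close>. Where a value is
  \<open>-\<infinity>\<close>, its bound can be any real, so it is solved for after the other one is chosen.
\<close>

lemma upper_semicontinuous_convex_combination:
  assumes usc: "upper_semicontinuous \<phi>" "upper_semicontinuous \<psi>"
    and fin: "\<And>y. \<phi> y < \<infinity>" "\<And>y. \<psi> y < \<infinity>" and s: "0 < s" "s < 1"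
  shows "upper_semicontinuous (\<lambda>y. ereal (1 - s) * \<phi> y + ereal s * \<psi> y)"
  unfolding upper_semicontinuous_def Limsup_le_iff
proof (intro allI impI)
  fix x c assume "ereal (1 - s) * \<phi> x + ereal s * \<psi> x < c"
  then obtain d where d: "ereal (1 - s) * \<phi> x + ereal s * \<psi> x < ereal d" "ereal d < c"
    using ereal_dense2 by blast
  obtain a b where ab: "\<phi> x < ereal a" "\<psi> x < ereal b" "(1 - s) * a + s * b = d"
  proof (cases "\<phi> x")
    case (real q)
    show ?thesis
    proof (cases "\<psi> x")
      case (real r)
      define e where "e = d - ((1 - s) * q + s * r)"
      have "e > 0" using d(1) real \<open>\<phi> x = ereal q\<close> by (simp add: e_def)
      thus ?thesis using real \<open>\<phi> x = ereal q\<close>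
        by (intro that[of "q + e" "r + e"]) (auto simp: e_def algebra_simps)
    next
      case MInf
      thus ?thesis using real s by (intro that[of "q + 1" "(d - (1 - s) * (q + 1)) / s"]) auto
    qed (use fin[of x] in auto)
  next
    case MInf
    obtain b where "\<psi> x < ereal b" using ereal_dense2[OF fin(2)[of x]] by blast
    thus ?thesis using MInf s by (intro that[of "(d - s * b) / (1 - s)" b]) auto
  qed (use fin[of x] in auto)
  have "\<forall>\<^sub>F y in at x. \<phi> y < ereal a" "\<forall>\<^sub>F y in at x. \<psi> y < ereal b"
    using usc ab(1,2) unfolding upper_semicontinuous_def Limsup_le_iff by blast+
  thus "\<forall>\<^sub>F y in at x. ereal (1 - s) * \<phi> y + ereal s * \<psi> y < c"
  proof eventually_elim
    case (elim y)
    have "ereal (1 - s) * \<phi> y + ereal s * \<psi> y < ereal ((1 - s) * a + s * b)"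
      using elim s by (cases "\<phi> y"; cases "\<psi> y") (auto intro!: add_strict_mono)
    thus ?case using ab(3) d(2) by (metis order.strict_trans)
  qed
qed

text \<open>
  The function \<open>\<psi> + t \<Delta>\<close> is the convex combination of \<open>\<psi>\<close> and \<open>\<psi> + \<epsilon> \<Delta>\<close> with weight
  \<open>t / \<epsilon>\<close> on the latter.
\<close>

lemma SC_perturbation_segment:
  assumes "\<psi> \<in> SC" "(\<lambda>y. \<psi> y + ereal (\<epsilon> * \<Delta> y)) \<in> SC" "0 < t" "t < \<epsilon>"
  shows "(\<lambda>y. \<psi> y + ereal (t * \<Delta> y)) \<in> SC"
proof -
  define \<phi> where "\<phi> = (\<lambda>y. \<psi> y + ereal (\<epsilon> * \<Delta> y))"
  define s where "s = t / \<epsilon>"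
  have s: "0 < s" "s < 1" and ts: "t = s * \<epsilon>" using assms(3,4) by (auto simp: s_def)
  have fin: "\<psi> y < \<infinity>" "\<phi> y < \<infinity>" for y
    using assms(1,2) by (auto simp: SC_def concave_ext_def \<phi>_def)
  have comb: "\<psi> y + ereal (t * \<Delta> y) = ereal (1 - s) * \<psi> y + ereal s * \<phi> y" for y
    using fin(1)[of y] s by (cases "\<psi> y") (auto simp: \<phi>_def ts algebra_simps)
  have "concave_ext (\<lambda>y. \<psi> y + ereal (t * \<Delta> y))"
    unfolding comb using assms s
    by (intro concave_ext_convex_combination) (auto simp: SC_def \<phi>_def)
  moreover have "upper_semicontinuous (\<lambda>y. \<psi> y + ereal (t * \<Delta> y))"
    unfolding comb using assms s fin
    by (intro upper_semicontinuous_convex_combination) (auto simp: SC_def \<phi>_def)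
  moreover have "zero_symmetric (\<lambda>y. \<psi> y + ereal (t * \<Delta> y))"
    unfolding comb using assms(1,2) unfolding SC_def \<phi>_def[symmetric] zero_symmetric_def
    by (metis (mono_tags, lifting) mem_Collect_eq)
  moreover have "\<exists>y. \<psi> y + ereal (t * \<Delta> y) \<noteq> -\<infinity>"
    using assms(1) by (auto simp: SC_def)
  ultimately show ?thesis by (simp add: SC_def)
qed

section \<open>The two sides of the criterion\<close>

text \<open>
  Where neither the likelihood nor the mass degenerates, maximality can be used as an inequality
  between real numbers.
\<close>

lemma Phi_eq_real:
  assumes int: "integrable lborel (\<lambda>y. exp_ext (\<phi> y))"
    and pos: "\<And>i. i \<in> {1..n} \<Longrightarrow> 0 < mixture p u1 u2 (\<lambda>y. exp_ext (\<phi> y)) (x i)"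
  shows "Phi n x p u1 u2 \<phi> =
    ereal ((1 / real n) * (\<Sum>i=1..n. ln (mixture p u1 u2 (\<lambda>y. exp_ext (\<phi> y)) (x i)))
      - (\<integral>y. exp_ext (\<phi> y) \<partial>lborel))"
proof -
  have nn: "0 \<le> exp_ext a" for a by (simp add: exp_ext_def)
  have "(\<Sum>i=1..n. log_ext (mixture p u1 u2 (\<lambda>y. exp_ext (\<phi> y)) (x i)))
      = (\<Sum>i=1..n. ereal (ln (mixture p u1 u2 (\<lambda>y. exp_ext (\<phi> y)) (x i))))"
    using pos by (intro sum.cong) (force simp: log_ext_def)+
  moreover have "(\<integral>\<^sup>+y. ennreal (exp_ext (\<phi> y)) \<partial>lborel) = ennreal (\<integral>y. exp_ext (\<phi> y) \<partial>lborel)"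
    using int nn by (intro nn_integral_eq_integral) auto
  ultimately show ?thesis
    unfolding Phi_def by (simp add: nn)
qed

text \<open>
  The left-hand side is the derivative at \<open>s = 0\<close> of the convex function
  \<open>ln (a exp (s \<alpha>) + b exp (s \<beta>))\<close>, and the right-hand side is its increment from \<open>0\<close> to \<open>1\<close>.
  Jensen's inequality for \<open>exp\<close> yields this tangent bound without differentiation.
\<close>

lemma weighted_mean_le_ln_tilt:
  fixes a b \<alpha> \<beta> :: real
  assumes "0 < a" "0 < b"
  defines "w \<equiv> a / (a + b)"
  shows "w * \<alpha> + (1 - w) * \<beta> \<le> ln (a * exp \<alpha> + b * exp \<beta>) - ln (a + b)"
proof -
  have w: "0 < w" "w < 1" and aw: "a = w * (a + b)" and bw: "b = (1 - w) * (a + b)"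
    using assms by (auto simp: w_def field_simps)
  have pos: "0 < w * exp \<alpha> + (1 - w) * exp \<beta>"
    using w by (simp add: add_pos_pos)
  have "exp (w * \<alpha> + (1 - w) * \<beta>) \<le> w * exp \<alpha> + (1 - w) * exp \<beta>"
    using convex_onD[OF exp_convex, of "1 - w" \<alpha> \<beta>] w by simp
  hence "w * \<alpha> + (1 - w) * \<beta> \<le> ln (w * exp \<alpha> + (1 - w) * exp \<beta>)"
    using pos by (simp add: ln_ge_iff)
  also have "\<dots> = ln ((a + b) * (w * exp \<alpha> + (1 - w) * exp \<beta>)) - ln (a + b)"
    using pos assms(1,2) by (simp add: ln_mult)
  also have "(a + b) * (w * exp \<alpha> + (1 - w) * exp \<beta>) = a * exp \<alpha> + b * exp \<beta>"
    using aw bw by (metis distrib_left mult.assoc mult.commute)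
  finally show ?thesis .
qed

lemma exp_le_quadratic:
  fixes z :: real assumes "z \<le> 1" shows "exp z \<le> 1 + z + z\<^sup>2"
proof (cases "z \<ge> 0")
  case True thus ?thesis using exp_bound[of z] assms by simp
next
  case False
  \<comment> \<open>For negative \<open>z\<close>, compare both sides with \<open>1 / (1 - z)\<close>; the second comparison reduces to
    \<open>1 \<le> 1 - z ^ 3\<close>.\<close>
  have "1 - z \<le> exp (- z)" using exp_ge_add_one_self[of "- z"] by simp
  hence "exp z \<le> 1 / (1 - z)" using False by (simp add: exp_minus field_simps)
  also have "\<dots> \<le> 1 + z + z\<^sup>2"
  proof -
    have "z ^ 3 \<le> 0" using False by (simp add: power_le_zero_eq)
    hence "1 \<le> (1 + z + z\<^sup>2) * (1 - z)" by (simp add: algebra_simps power2_eq_square power3_eq_cube)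
    thus ?thesis using False by (simp add: divide_simps)
  qed
  finally show ?thesis .
qed

lemma integrable_mult_bounded:
  fixes f h :: "'a \<Rightarrow> real"
  assumes "integrable M f" "h \<in> borel_measurable M" "\<And>y. \<bar>h y\<bar> \<le> C"
  shows "integrable M (\<lambda>y. f y * h y)"
proof (rule Bochner_Integration.integrable_bound)
  show "integrable M (\<lambda>y. f y * C)" using assms(1) by simp
  show "(\<lambda>y. f y * h y) \<in> borel_measurable M" using assms by measurable
  have "\<bar>f y * h y\<bar> \<le> \<bar>f y * C\<bar>" for y
    unfolding abs_mult using assms(3)[of y] by (intro mult_left_mono) auto
  thus "AE y in M. norm (f y * h y) \<le> norm (f y * C)" by simp
qed

text \<open>
  Along a bounded exponential tilt the mass grows by \<open>t\<close> times the integral of \<open>f D\<close>, up to an error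
  quadratic in \<open>t\<close>. A linear lower bound on this growth therefore has at most that slope.
\<close>

lemma integral_exponential_tilt_first_order:
  fixes f D :: "'a \<Rightarrow> real" and L :: real
  assumes f: "integrable M f" "\<And>y. 0 \<le> f y"
    and D: "D \<in> borel_measurable M" "\<And>y. \<bar>D y\<bar> \<le> B"
    and \<epsilon>: "\<epsilon> > 0"
    and le: "\<And>t. 0 < t \<Longrightarrow> t < \<epsilon> \<Longrightarrow>
      t * L \<le> (\<integral>y. f y * exp (t * D y) \<partial>M) - (\<integral>y. f y \<partial>M)"
  shows "L \<le> (\<integral>y. f y * D y \<partial>M)"
proof -
  have B: "0 \<le> B" using D(2) abs_ge_zero order.trans by blast
  have i1: "integrable M (\<lambda>y. f y * D y)" by (rule integrable_mult_bounded[OF f(1) D])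
  have i2: "integrable M (\<lambda>y. f y * (D y)\<^sup>2)"
  proof (rule integrable_mult_bounded[OF f(1)])
    show "\<bar>(D y)\<^sup>2\<bar> \<le> B\<^sup>2" for y using power_mono[OF D(2)[of y], of 2] by simp
  qed (use D(1) in measurable)
  \<comment> \<open>The restriction \<open>t < 1 / (B + 1)\<close> makes the exponent \<open>t * D y\<close> at most \<open>1\<close>, where the
    quadratic bound on \<open>exp\<close> is valid; adding \<open>1\<close> covers the case \<open>B = 0\<close>.\<close>
  have bound: "L \<le> (\<integral>y. f y * D y \<partial>M) + t * (\<integral>y. f y * (D y)\<^sup>2 \<partial>M)"
    if t: "0 < t" "t < min \<epsilon> (1 / (B + 1))" for t
  proof -
    have tB: "t * B \<le> 1"
      using t B by (simp add: field_simps)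
    have tD: "t * D y \<le> t * B" for y using t D(2)[of y] by (intro mult_left_mono) auto
    have i3: "integrable M (\<lambda>y. f y * exp (t * D y))"
    proof (rule integrable_mult_bounded[OF f(1)])
      show "\<bar>exp (t * D y)\<bar> \<le> exp (t * B)" for y using tD[of y] by simp
    qed (use D(1) in measurable)
    have "t * L \<le> (\<integral>y. f y * exp (t * D y) \<partial>M) - (\<integral>y. f y \<partial>M)" using le t by simp
    also have "(\<integral>y. f y * exp (t * D y) \<partial>M)
        \<le> (\<integral>y. f y + t * (f y * D y) + t\<^sup>2 * (f y * (D y)\<^sup>2) \<partial>M)"
    proof (rule integral_mono[OF i3])
      show "integrable M (\<lambda>y. f y + t * (f y * D y) + t\<^sup>2 * (f y * (D y)\<^sup>2))"
        using f i1 i2 by simp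
      fix y
      have "f y * exp (t * D y) \<le> f y * (1 + t * D y + (t * D y)\<^sup>2)"
        using tD[of y] tB f(2) by (intro mult_left_mono exp_le_quadratic) auto
      thus "f y * exp (t * D y) \<le> f y + t * (f y * D y) + t\<^sup>2 * (f y * (D y)\<^sup>2)"
        by (simp add: algebra_simps power_mult_distrib)
    qed
    also have "\<dots> = (\<integral>y. f y \<partial>M) + t * (\<integral>y. f y * D y \<partial>M) + t\<^sup>2 * (\<integral>y. f y * (D y)\<^sup>2 \<partial>M)"
      using f i1 i2 by simp
    finally have "t * L \<le> t * ((\<integral>y. f y * D y \<partial>M) + t * (\<integral>y. f y * (D y)\<^sup>2 \<partial>M))"
      by (simp add: algebra_simps power2_eq_square)
    thus ?thesis using t(1) by simp
  qed
  have "((\<lambda>t. (\<integral>y. f y * D y \<partial>M) + t * (\<integral>y. f y * (D y)\<^sup>2 \<partial>M))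
      \<longlongrightarrow> (\<integral>y. f y * D y \<partial>M) + 0 * (\<integral>y. f y * (D y)\<^sup>2 \<partial>M)) (at_right 0)"
    by (intro tendsto_intros)
  moreover have "\<forall>\<^sub>F t in at_right 0. L \<le> (\<integral>y. f y * D y \<partial>M) + t * (\<integral>y. f y * (D y)\<^sup>2 \<partial>M)"
    unfolding eventually_at_right_field using bound \<epsilon> B
    by (intro exI[of _ "min \<epsilon> (1 / (B + 1))"]) auto
  ultimately show ?thesis by (auto dest: tendsto_lowerbound)
qed

section \<open>Variation of the maximizer\<close>

text \<open>
  This is the deterministic core: the sample enters only through the fact that all shifted points
  lie in the support of the maximizer. The tilt is described by a function \<open>D\<close> that agrees with
  \<open>\<Delta>\<close> on the support and vanishes elsewhere, since nothing is known about the size or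
  measurability of \<open>\<Delta>\<close> off the support.
\<close>

lemma MLE_directional_derivative_nonpos:
  fixes \<psi> :: "real \<Rightarrow> ereal" and \<Delta> :: "real \<Rightarrow> real"
  defines "f \<equiv> \<lambda>y. exp_ext (\<psi> y)"
  assumes p: "0 < p" "p < 1"
    and max: "is_arg_max (Phi n x p u1 u2) (\<lambda>\<phi>. \<phi> \<in> SC) \<psi>"
    and dom: "\<And>y. \<psi> y = -\<infinity> \<longleftrightarrow> y \<notin> {- Z..Z}"
    and data: "\<And>i. i \<in> {1..n} \<Longrightarrow> \<bar>x i - u1\<bar> \<le> Z \<and> \<bar>x i - u2\<bar> \<le> Z"
    and \<epsilon>: "\<epsilon> > 0" and \<Delta>_SC: "(\<lambda>y. \<psi> y + ereal (\<epsilon> * \<Delta> y)) \<in> SC"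
  shows "(1 / real n) * (\<Sum>i=1..n. p_hat p u1 u2 f (x i) * \<Delta> (x i - u1)
            + (1 - p_hat p u1 u2 f (x i)) * \<Delta> (x i - u2))
         \<le> (\<integral>y. f y * \<Delta> y \<partial>lborel)"
    (is "?L \<le> _")
proof -
  have \<psi>: "\<psi> \<in> SC" using max by (simp add: is_arg_max_def)
  hence fin: "\<psi> y < \<infinity>" for y by (simp add: SC_def concave_ext_def)
  define g where "g y = exp_ext (\<psi> y + ereal (\<epsilon> * \<Delta> y))" for y
  \<comment> \<open>Off the support both densities are \<open>0\<close> and \<open>ln 0 = 0\<close>, so \<open>D\<close> vanishes there without a case
    distinction; its measurability is inherited from the two densities.\<close>
  define D where "D y = (ln (g y) - ln (f y)) / \<epsilon>" for y
  define B where "B = (\<bar>ln (g 0)\<bar> + \<bar>ln (g Z)\<bar> + \<bar>ln (f 0)\<bar> + \<bar>ln (f Z)\<bar>) / \<epsilon>"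
  have f0: "0 \<le> f y" for y by (simp add: f_def exp_ext_def)
  have fpos: "0 < f y \<longleftrightarrow> \<bar>y\<bar> \<le> Z" for y
    using exp_ext_pos[OF fin[of y]] dom[of y] by (auto simp: f_def)
  have gf: "g y = f y * exp (\<epsilon> * \<Delta> y)" for y by (simp add: g_def f_def exp_ext_add[OF fin])
  have out: "f y = 0" if "\<not> \<bar>y\<bar> \<le> Z" for y using fpos[of y] f0[of y] that by simp
  have D_eq: "D y = \<Delta> y" if "\<bar>y\<bar> \<le> Z" for y
    using fpos[of y] that \<epsilon> by (simp add: D_def gf ln_mult)
  have D_out: "D y = 0" if "\<not> \<bar>y\<bar> \<le> Z" for y using out[OF that] by (simp add: D_def gf)
  have tilt: "exp_ext (\<psi> y + ereal (t * \<Delta> y)) = f y * exp (t * D y)" for t y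
    using D_eq[of y] out[of y] by (cases "\<bar>y\<bar> \<le> Z") (auto simp: exp_ext_add[OF fin] f_def)
  have fm: "f \<in> borel_measurable borel"
    using exp_ext_measurable[of \<psi>] \<psi> by (simp add: f_def SC_def)
  moreover have gm: "g \<in> borel_measurable borel"
    using exp_ext_measurable[OF _ _, of "\<lambda>y. \<psi> y + ereal (\<epsilon> * \<Delta> y)"] \<Delta>_SC
    by (simp add: g_def[abs_def] SC_def)
  ultimately have Dm: "D \<in> borel_measurable borel"
    unfolding D_def[abs_def] by measurable
  have f_mono: "f b \<le> f a" if "\<bar>a\<bar> \<le> \<bar>b\<bar>" for a b
    using zero_symmetric_concave_mono_abs[of \<psi> a b] \<psi> that fin
    by (auto simp: f_def SC_def intro!: exp_ext_mono)
  have g_mono: "g b \<le> g a" if "\<bar>a\<bar> \<le> \<bar>b\<bar>" for a b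
    using zero_symmetric_concave_mono_abs[of "\<lambda>y. \<psi> y + ereal (\<epsilon> * \<Delta> y)" a b] \<Delta>_SC that
    by (auto simp: g_def SC_def concave_ext_def intro!: exp_ext_mono)
  have D_bound: "\<bar>D y\<bar> \<le> B" for y
  proof (cases "\<bar>y\<bar> \<le> Z")
    case True
    hence Z: "0 \<le> Z" by simp
    have pos: "0 < f Z" "0 < g Z" "0 < f y" "0 < g y" using Z True fpos by (auto simp: gf)
    have "f Z \<le> f y" "f y \<le> f 0" "g Z \<le> g y" "g y \<le> g 0"
      using True Z by (auto intro!: f_mono g_mono)
    hence "ln (f Z) \<le> ln (f y)" "ln (f y) \<le> ln (f 0)" "ln (g Z) \<le> ln (g y)" "ln (g y) \<le> ln (g 0)"
      using pos by (auto intro!: ln_mono)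
    hence "\<bar>ln (g y) - ln (f y)\<bar> \<le> \<bar>ln (g 0)\<bar> + \<bar>ln (g Z)\<bar> + \<bar>ln (f 0)\<bar> + \<bar>ln (f Z)\<bar>" by linarith
    thus ?thesis using \<epsilon> by (simp add: D_def B_def divide_right_mono)
  next
    case False
    thus ?thesis using D_out \<epsilon> by (simp add: B_def)
  qed
  have f_int: "integrable lborel f"
  proof (rule integrableI_bounded_set[where A = "{- Z..Z}" and B = "f 0"])
    show "AE y in lborel. y \<in> {- Z..Z} \<longrightarrow> norm (f y) \<le> f 0"
      using f_mono[of 0] f0 by simp
    show "AE y in lborel. y \<notin> {- Z..Z} \<longrightarrow> f y = 0" using out by auto
  qed (use fm in \<open>auto simp: emeasure_lborel_Icc_eq\<close>)
  have tilt_int: "integrable lborel (\<lambda>y. f y * exp (t * D y))" for t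
  proof (rule integrable_mult_bounded[OF f_int])
    show "\<bar>exp (t * D y)\<bar> \<le> exp (\<bar>t\<bar> * B)" for y
    proof -
      have "\<bar>t * D y\<bar> \<le> \<bar>t\<bar> * B" unfolding abs_mult by (intro mult_left_mono D_bound) simp
      thus ?thesis by simp
    qed
  qed (use Dm in measurable)
  have mix_pos: "0 < mixture p u1 u2 (\<lambda>y. f y * exp (t * D y)) (x i)" if "i \<in> {1..n}" for i t
    using data[OF that] p fpos by (auto simp: mixture_def intro!: add_pos_pos mult_pos_pos)
  have "?L \<le> (\<integral>y. f y * D y \<partial>lborel)"
  proof (rule integral_exponential_tilt_first_order[OF f_int f0 _ D_bound \<epsilon>])
    fix t :: real assume t: "0 < t" "t < \<epsilon>"
    define \<phi> where "\<phi> = (\<lambda>y. \<psi> y + ereal (t * \<Delta> y))"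
    have \<phi>f: "(\<lambda>y. exp_ext (\<phi> y)) = (\<lambda>y. f y * exp (t * D y))" by (simp add: \<phi>_def tilt)
    have "\<phi> \<in> SC" unfolding \<phi>_def by (rule SC_perturbation_segment[OF \<psi> \<Delta>_SC t])
    hence "Phi n x p u1 u2 \<phi> \<le> Phi n x p u1 u2 \<psi>" using max by (simp add: is_arg_max_linorder)
    moreover have "Phi n x p u1 u2 \<phi> =
      ereal ((1 / real n) * (\<Sum>i=1..n. ln (mixture p u1 u2 (\<lambda>y. f y * exp (t * D y)) (x i)))
        - (\<integral>y. f y * exp (t * D y) \<partial>lborel))"
      using Phi_eq_real[of \<phi> n p u1 u2 x, unfolded \<phi>f] tilt_int mix_pos by blast
    moreover have "Phi n x p u1 u2 \<psi> =
      ereal ((1 / real n) * (\<Sum>i=1..n. ln (mixture p u1 u2 f (x i))) - (\<integral>y. f y \<partial>lborel))"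
      using Phi_eq_real[of \<psi> n p u1 u2 x] f_int mix_pos[where t=0] by (simp add: f_def)
    ultimately have "(1 / real n) * (\<Sum>i=1..n. ln (mixture p u1 u2 (\<lambda>y. f y * exp (t * D y)) (x i))
          - ln (mixture p u1 u2 f (x i)))
        \<le> (\<integral>y. f y * exp (t * D y) \<partial>lborel) - (\<integral>y. f y \<partial>lborel)"
      by (simp add: sum_subtractf right_diff_distrib diff_divide_distrib)
    moreover have "t * ?L \<le> (1 / real n) *
        (\<Sum>i=1..n. ln (mixture p u1 u2 (\<lambda>y. f y * exp (t * D y)) (x i)) - ln (mixture p u1 u2 f (x i)))"
    proof -
      have "t * ?L = (1 / real n) * (\<Sum>i=1..n. p_hat p u1 u2 f (x i) * (t * \<Delta> (x i - u1))
            + (1 - p_hat p u1 u2 f (x i)) * (t * \<Delta> (x i - u2)))"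
        by (simp add: sum_distrib_left algebra_simps)
      also have "\<dots> \<le> (1 / real n) *
        (\<Sum>i=1..n. ln (mixture p u1 u2 (\<lambda>y. f y * exp (t * D y)) (x i)) - ln (mixture p u1 u2 f (x i)))"
      proof (intro mult_left_mono sum_mono)
        fix i assume i: "i \<in> {1..n}"
        have "0 < p * f (x i - u1)" "0 < (1 - p) * f (x i - u2)" using data[OF i] p fpos by auto
        from weighted_mean_le_ln_tilt[OF this, of "t * \<Delta> (x i - u1)" "t * \<Delta> (x i - u2)"]
        show "p_hat p u1 u2 f (x i) * (t * \<Delta> (x i - u1))
            + (1 - p_hat p u1 u2 f (x i)) * (t * \<Delta> (x i - u2))
          \<le> ln (mixture p u1 u2 (\<lambda>y. f y * exp (t * D y)) (x i)) - ln (mixture p u1 u2 f (x i))"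
          using D_eq data[OF i] by (simp add: p_hat_def mixture_def mult.assoc)
      qed simp
      finally show ?thesis .
    qed
    ultimately show "t * ?L \<le> (\<integral>y. f y * exp (t * D y) \<partial>lborel) - (\<integral>y. f y \<partial>lborel)"
      by linarith
  qed (use Dm in simp)
  also have "(\<integral>y. f y * D y \<partial>lborel) = (\<integral>y. f y * \<Delta> y \<partial>lborel)"
    using D_eq out by (intro Bochner_Integration.integral_cong refl) (metis mult_zero_left)
  finally show ?thesis .
qed

theorem proposition2p2:
  fixes M :: "'a measure" and X :: "nat \<Rightarrow> 'a \<Rightarrow> real" and n :: nat
    and f0 :: "real \<Rightarrow> real" and pi0 u01 u02 :: real
    and pi_est u1_est u2_est :: "(nat \<Rightarrow> real) \<Rightarrow> real"
    and \<omega> :: 'a and x :: "nat \<Rightarrow> real" and p u1 u2 :: real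
    and \<psi> :: "real \<Rightarrow> ereal" and f_hat :: "real \<Rightarrow> real"
    and \<Delta> :: "real \<Rightarrow> real" and \<epsilon> :: real
  assumes prob: "prob_space M"
    and n: "n \<ge> 1"
    and f0: "f0 \<in> SLC1"
    and pi0: "pi0 \<in> {0<..<1} - {1/2}"
    and u0: "u01 \<noteq> u02"
    and indep: "prob_space.indep_vars M (\<lambda>_. borel) X {1..n}"
    and distr: "\<And>i. i \<in> {1..n} \<Longrightarrow>
                  distributed M lborel (X i) (\<lambda>y. ennreal (mixture pi0 u01 u02 f0 y))"
    and pi_est: "\<And>\<omega>. \<omega> \<in> space M \<Longrightarrow> pi_est (obs n X \<omega>) \<in> {0<..<1} - {1/2}"
    and u_est: "\<And>\<omega>. \<omega> \<in> space M \<Longrightarrow> u1_est (obs n X \<omega>) < u2_est (obs n X \<omega>)"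
    and \<omega>: "\<omega> \<in> space M"
    and x: "x = obs n X \<omega>"
    and p: "p = pi_est x" and u1: "u1 = u1_est x" and u2: "u2 = u2_est x"
    and \<psi>_sym: "zero_symmetric \<psi>"
    and \<psi>_concave: "concave_ext \<psi>"
    and \<psi>_dom: "\<And>y. \<psi> y = -\<infinity> \<longleftrightarrow> y \<notin> {- Z_max n x u1 u2..Z_max n x u1 u2}"
    and \<psi>_deriv: "((\<lambda>y. real_of_ereal (\<psi> y)) has_real_derivative 0) (at 0)"
    and mle: "is_MLE n x p u1 u2 f_hat"
    and f_hat: "(\<lambda>y. exp_ext (\<psi> y)) = f_hat"
    and \<Delta>_sym: "zero_symmetric \<Delta>"
    and \<epsilon>: "\<epsilon> > 0"
    and \<Delta>_SC: "(\<lambda>y. \<psi> y + ereal (\<epsilon> * \<Delta> y)) \<in> SC"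
  shows "(1 / real n) * (\<Sum>i=1..n. p_hat p u1 u2 f_hat (x i) * \<Delta> (x i - u1)
            + (1 - p_hat p u1 u2 f_hat (x i)) * \<Delta> (x i - u2))
         \<le> (\<integral>y. f_hat y * \<Delta> y \<partial>lborel)"
proof -
  obtain \<phi> where \<phi>: "is_arg_max (Phi n x p u1 u2) (\<lambda>\<phi>. \<phi> \<in> SC) \<phi>" "f_hat = (\<lambda>y. exp_ext (\<phi> y))"
    using mle by (auto simp: is_MLE_def)
  \<comment> \<open>The exponential is injective on \<open>[-\<infinity>, \<infinity>)\<close>, so the exponent of the maximum likelihood
    estimator is determined by the estimator.\<close>
  have "\<phi> = \<psi>"
  proof
    fix y
    have "\<phi> y < \<infinity>" "\<psi> y < \<infinity>"
      using \<phi>(1) \<psi>_concave by (auto simp: is_arg_max_def SC_def concave_ext_def)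
    moreover have "exp_ext (\<phi> y) = exp_ext (\<psi> y)" using \<phi>(2) f_hat by metis
    ultimately show "\<phi> y = \<psi> y" by (rule exp_ext_inject)
  qed
  hence max: "is_arg_max (Phi n x p u1 u2) (\<lambda>\<phi>. \<phi> \<in> SC) \<psi>" using \<phi>(1) by simp
  have p01: "0 < p" "p < 1" using pi_est[OF \<omega>] by (auto simp: p x)
  have data: "\<bar>x i - u1\<bar> \<le> Z_max n x u1 u2 \<and> \<bar>x i - u2\<bar> \<le> Z_max n x u1 u2" if "i \<in> {1..n}" for i
  proof -
    have "max \<bar>x i - u1\<bar> \<bar>x i - u2\<bar> \<le> Z_max n x u1 u2"
      unfolding Z_max_def using that by (intro Max_ge) auto
    thus ?thesis by simp
  qed
  show ?thesis
    using MLE_directional_derivative_nonpos[OF p01 max \<psi>_dom data \<epsilon> \<Delta>_SC] 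
    by (simp add: f_hat fun_cong[OF f_hat])
qed

end
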